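(* For all $x\in\mathbb{R}\setminus\{0\}$: a) $D^\prime_x$ has a non-differentiable edge (i.e. is not differentiable) along the diagonal $y=z$ if $D^\prime>0$ (i.e. $x>0$) and along the diagonal $y=-z$ if $D^\prime<0$ (i.e. $x<0$). There is a non-smooth saddle point at the origin $(y,z)=(0,0)$. b) For fixed $z$, respectively fixed $y$, $$\lim_{y\to\pm\infty}D^\prime_x=(e^{2x}-1)\cdot\begin{cases}(e^{2x}+e^{x\pm z})^{-1}&x>0\\(e^{x\mp z}+1)^{-1}&x<0\end{cases},\qquad \lim_{z\to\pm\infty}D^\prime_x=(e^{2x}-1)\cdot\begin{cases}(e^{2x}+e^{x\pm y})^{-1}&x>0\\(e^{x\mp y}+1)^{-1}&x<0\end{cases}.$$ Thus the limit functions have range $(0,1-e^{-2x})$ for $x>0$ and $(e^{2x}-1,0)$ for $x<0$, where $0$ is obtained as limit for $y\to\pm\infty$, $z\to\pm\infty$ (equal signs) if $x>0$ and for $y\to\mp\infty$, $z\to\pm\infty$ (opposite signs) if $x<0$. Moreover: c) $\lim_{x\to\pm\infty}D^\prime_x(y,z)=\pm1$ for every $(y,z)\in\mathbb{R}^2$. d) $D^\prime$ (in the coordinates $(x,y,z)$) can be continuously extended to $\bar{\mathbb{R}}^3$ except for the vertices $V_g$, i.e. to $\bar{\mathbb{R}}^3\setminus V_g$. e) $D^\prime$ (as a function on $\mathbb{T}$) can be continuously extended to $\overline{\mathbb{T}}$ except for the edges and vertices, i.e. to the complement in $\overline{\mathbb{T}}$ of its edges and vertices.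
   Context: $\mathbb{T}$ is the set of real $2\times2$ matrices $t=\begin{pmatrix}p_{00}&p_{01}\\ p_{10}&p_{11}\end{pmatrix}$ with all $p_{ij}>0$ and $\sum_{i,j}p_{ij}=1$; $p_{i.}=p_{i0}+p_{i1}$, $p_{.j}=p_{0j}+p_{1j}$. $\overline{\mathbb{T}}$ is its closure (all $p_{ij}\ge0$), a tetrahedron whose edges are the sets where two of the $p_{ij}$ vanish and whose vertices are the tables with some $p_{ij}=1$. Lewontin's $D^\prime$ is $D^\prime=D/D_{max}$ with $D=p_{00}p_{11}-p_{01}p_{10}$ and $D_{max}=\min\{p_{0.}p_{.1},p_{.0}p_{1.}\}$ if $D\ge0$, $D_{max}=\min\{p_{0.}p_{.0},p_{1.}p_{.1}\}$ if $D<0$. Margin transformation coordinates on $\mathbb{T}$ are given by the diffeomorphism $\Psi:\mathbb{R}^3\to\mathbb{T}$, $\Psi(x,y,z)=\frac{1}{e^{x+y+z}+e^x+e^y+e^z}\begin{pmatrix}e^{x+y+z}&e^y\\ e^z&e^x\end{pmatrix}$; $D^\prime(x,y,z)$ means $D^\prime(\Psi(x,y,z))$, and for fixed $x$, $D^\prime_x(y,z)=D^\prime(x,y,z)$ (the margin weighting function). Explicitly, $D^\prime(x,y,z)=(e^{2x}-1)e^{y+z}/M$ where $M=(e^{x+y+z}+e^y)(e^x+e^y)$ if $x>0,y<z$; $M=(e^{x+y+z}+e^z)(e^x+e^z)$ if $x>0,y\ge z$; $M=(e^{x+y+z}+e^y)(e^{x+y+z}+e^z)$ if $x<0,y<-z$;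 $M=(e^x+e^y)(e^x+e^z)$ if $x<0,y\ge-z$. A non-smooth saddle point of a function on $\mathbb{R}^2$ is a point at which the function is not differentiable and such that the function restricted to one line through the point has a strict local maximum there and restricted to another line through the point has a strict local minimum there. $\bar{\mathbb{R}}=\mathbb{R}\cup\{-\infty,+\infty\}$ is the two-point compactification, $\bar{\mathbb{R}}^3$ the resulting cube; writing $\pm$ for $\pm\infty$, $V_g=\{(+++),(+--),(-+-),(--+)\}$. *)

theory Defs
  imports "HOL-Analysis.Analysis"
begin

(* Matrices of type real^2^2 are indexed by 1 and 2, as in the HOL-Analysis library; the table entry
   p_ij with i, j in {0, 1} is the matrix entry in row i + 1 and column j + 1. *)

definition tables :: "(real^2^2) set" where
  "tables = {t. (\<forall>i j. t $ i $ j > 0) \<and> (\<Sum>i\<in>UNIV. \<Sum>j\<in>UNIV. t $ i $ j) = 1}"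

definition row_margin :: "real^2^2 \<Rightarrow> 2 \<Rightarrow> real" where
  "row_margin t i = (\<Sum>j\<in>UNIV. t $ i $ j)"

definition col_margin :: "real^2^2 \<Rightarrow> 2 \<Rightarrow> real" where
  "col_margin t j = (\<Sum>i\<in>UNIV. t $ i $ j)"

definition table_edges :: "(real^2^2) set" where
  "table_edges =
     {t \<in> closure tables. \<exists>i j k l. (i, j) \<noteq> (k, l) \<and> t $ i $ j = 0 \<and> t $ k $ l = 0}"

definition table_vertices :: "(real^2^2) set" where
  "table_vertices = {t \<in> closure tables. \<exists>i j. t $ i $ j = 1}"

definition lewontin_D :: "real^2^2 \<Rightarrow> real" where
  "lewontin_D t = t $ 1 $ 1 * t $ 2 $ 2 - t $ 1 $ 2 * t $ 2 $ 1"

definition lewontin_Dmax :: "real^2^2 \<Rightarrow> real" where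
  "lewontin_Dmax t =
     (if lewontin_D t \<ge> 0
      then min (row_margin t 1 * col_margin t 2) (col_margin t 1 * row_margin t 2)
      else min (row_margin t 1 * col_margin t 1) (row_margin t 2 * col_margin t 2))"

definition lewontin_D' :: "real^2^2 \<Rightarrow> real" where
  "lewontin_D' t = lewontin_D t / lewontin_Dmax t"

definition Psi :: "real \<Rightarrow> real \<Rightarrow> real \<Rightarrow> real^2^2" where
  "Psi x y z = (1 / (exp (x + y + z) + exp x + exp y + exp z)) *\<^sub>R
     vector [vector [exp (x + y + z), exp y],
             vector [exp z, exp x]]"

definition margin_weight :: "real \<Rightarrow> real \<times> real \<Rightarrow> real" where
  "margin_weight x = (\<lambda>(y, z). lewontin_D' (Psi x y z))"

definition line_through :: "real \<times> real \<Rightarrow> real \<times> real \<Rightarrow> (real \<times> real) set" where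
  "line_through p v = range (\<lambda>t. p + t *\<^sub>R v)"

definition nonsmooth_saddle_point :: "(real \<times> real \<Rightarrow> real) \<Rightarrow> real \<times> real \<Rightarrow> bool" where
  "nonsmooth_saddle_point f p \<longleftrightarrow>
     \<not> f differentiable (at p) \<and>
     (\<exists>v w. v \<noteq> 0 \<and> w \<noteq> 0 \<and> line_through p v \<noteq> line_through p w \<and>
        (\<forall>\<^sub>F q in at p within line_through p v. f q < f p) \<and>
        (\<forall>\<^sub>F q in at p within line_through p w. f q > f p))"

definition V_g :: "(ereal \<times> ereal \<times> ereal) set" where
  "V_g = {(\<infinity>, \<infinity>, \<infinity>), (\<infinity>, -\<infinity>, -\<infinity>), (-\<infinity>, \<infinity>, -\<infinity>), (-\<infinity>, -\<infinity>, \<infinity>)}"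

end

theory Submission
  imports Defs "HOL-Real_Asymp.Real_Asymp"
begin

text \<open>
  Let \<open>s\<close> be the logistic function. For \<open>x \<ge> 0\<close>, clearing denominators gives
  \<open>D' = (1 - exp (- 2 x)) * max (s (x + z) * s (x - y)) (s (x + y) * s (x - z))\<close>,
  and swapping the rows of the table gives \<open>D' (- x, - y, z) = - D' (x, y, z)\<close>.
  Along \<open>(a + s, a - s)\<close> the two products are mirror images of each other with nonzero slope at
  \<open>s = 0\<close>, so the maximum has a kink there. The limits follow from those of \<open>s\<close>. Since \<open>s\<close> extends
  continuously to \<open>[- \<infinity>, \<infinity>]\<close>, the formula extends wherever the sums are determinate; for
  \<open>x = \<infinity>\<close> it is enough that one product is determinate, because it then tends to the upper
  bound 1, and both fail only on \<open>V_g\<close>. At \<open>x = 0\<close> the prefactor vanishes. On the closed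
  tetrahedron without its edges all margins are positive, so \<open>D'\<close> itself is continuous.
\<close>

section \<open>Invariance of \<open>lewontin_D'\<close> under scaling and its sign change under
  reflection\<close>

lemma lewontin_D'_scaleR:
  assumes "c > 0"
  shows "lewontin_D' (c *\<^sub>R t) = lewontin_D' t"
proof -
  have row: "row_margin (c *\<^sub>R t) i = c * row_margin t i"
    and col: "col_margin (c *\<^sub>R t) i = c * col_margin t i" for i
    by (simp_all add: row_margin_def col_margin_def sum_distrib_left)
  have prod: "(c * a) * (c * b) = c\<^sup>2 * (a * b)" for a b
    by (simp add: power2_eq_square)
  have D: "lewontin_D (c *\<^sub>R t) = c\<^sup>2 * lewontin_D t"
    by (simp add: lewontin_D_def power2_eq_square algebra_simps)
  have min: "min (c\<^sup>2 * a) (c\<^sup>2 * b) = c\<^sup>2 * min a b" for a b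
    by (simp add: min_mult_distrib_left)
  have "lewontin_Dmax (c *\<^sub>R t) = c\<^sup>2 * lewontin_Dmax t"
    using assms by (simp add: lewontin_Dmax_def D row col prod min zero_le_mult_iff)
  then show ?thesis
    using assms by (simp add: lewontin_D'_def D)
qed

text \<open>The swap negates \<open>lewontin_D\<close> and exchanges the two minima in the case
  distinction of \<open>lewontin_Dmax\<close>.\<close>

lemma lewontin_D'_swap_rows:
  "lewontin_D' (vector [vector [c, d], vector [a, b]]) =
    - lewontin_D' (vector [vector [a, b], vector [c, d]])"
  by (auto simp: lewontin_D'_def lewontin_Dmax_def lewontin_D_def row_margin_def col_margin_def
      sum_2 algebra_simps min.commute minus_divide_left simp del: divide_minus_left)

lemma margin_weight_eq:
  "margin_weight x (y, z) =
    lewontin_D' (vector [vector [exp (x + y + z), exp y], vector [exp z, exp x]])"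
  unfolding margin_weight_def Psi_def
  by (simp add: lewontin_D'_scaleR add_pos_pos)

text \<open>Up to the factor \<open>exp (x + y)\<close>, the table of the reflected point is the
  original one with its rows swapped. This reduces negative \<open>x\<close> to positive
  \<open>x\<close> throughout.\<close>

lemma margin_weight_reflect: "margin_weight (- x) (- y, z) = - margin_weight x (y, z)"
proof -
  have "exp (x + y) *\<^sub>R (vector [vector [exp (- x + - y + z), exp (- y)], vector [exp z, exp (- x)]] :: real^2^2)
      = vector [vector [exp z, exp x], vector [exp (x + y + z), exp y]]"
    by (simp add: vec_eq_iff forall_2 flip: exp_add)
  then show ?thesis
    unfolding margin_weight_eq
    by (metis exp_gt_zero lewontin_D'_scaleR lewontin_D'_swap_rows)
qed

section \<open>The logistic function and the closed form of the margin weight\<close>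

definition logistic :: "real \<Rightarrow> real" where
  "logistic u = inverse (1 + exp (- u))"

lemma logistic_pos: "0 < logistic u"
  and logistic_less_1: "logistic u < 1"
  by (simp_all add: logistic_def add_pos_pos inverse_less_1_iff)

lemma logistic_less_iff [simp]: "logistic u < logistic v \<longleftrightarrow> u < v"
  by (simp add: logistic_def add_pos_pos)

lemma logistic_le_iff [simp]: "logistic u \<le> logistic v \<longleftrightarrow> u \<le> v"
  by (meson linorder_not_le logistic_less_iff)

lemma logistic_at_top: "(logistic \<longlongrightarrow> 1) at_top"
  and logistic_at_bot: "(logistic \<longlongrightarrow> 0) at_bot"
  unfolding logistic_def by real_asymp+

lemma range_logistic: "range logistic = {0<..<1}"
proof (intro equalityI subsetI)
  fix p :: real assume "p \<in> {0<..<1}"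
  \<comment> \<open>The preimage is the log odds of \<open>p\<close>.\<close>
  then have "p = logistic (ln (p / (1 - p)))"
    by (simp add: logistic_def exp_minus field_simps)
  then show "p \<in> range logistic" by blast
qed (auto simp: logistic_pos logistic_less_1)

lemma DERIV_logistic [derivative_intros]:
  assumes "(f has_real_derivative f') (at t within S)"
  shows "((\<lambda>t. logistic (f t)) has_real_derivative
    f' * logistic (f t) * (1 - logistic (f t))) (at t within S)"
proof -
  have "1 + exp (- f t) > 0" by (simp add: add_pos_pos)
  then show ?thesis unfolding logistic_def
    by (auto intro!: derivative_eq_intros assms simp: field_simps power2_eq_square)
qed

lemma divide_min_eq_max:
  fixes a b n :: real
  assumes "a > 0" "b > 0" "n \<ge> 0"
  shows "n / min a b = max (n / a) (n / b)"
proof (cases "a \<le> b")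
  case True
  then have "n / b \<le> n / a" using assms by (intro divide_left_mono) auto
  then show ?thesis using True by simp
next
  case False
  then have "n / a \<le> n / b" using assms by (intro divide_left_mono) auto
  then show ?thesis using False by simp
qed

text \<open>The odds ratio is \<open>exp (2 * x)\<close>, so D equals
  \<open>1 - exp (- 2 * x)\<close> times the product of the two diagonal entries. Each logistic
  factor is a diagonal entry divided by one of its margins: \<open>logistic (x + z)\<close> and
  \<open>logistic (x + y)\<close> belong to the first row and column,
  \<open>logistic (x - z)\<close> and \<open>logistic (x - y)\<close> to the second. Dividing by the
  minimum of two denominators gives the maximum of the quotients.\<close>

lemma margin_weight_x_nonneg:
  assumes "x \<ge> 0"
  shows "margin_weight x (y, z) =
    (1 - exp (- 2 * x)) *
      max (logistic (x + z) * logistic (x - y)) (logistic (x + y) * logistic (x - z))"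
proof -
  define A B C where "A = exp x" and "B = exp y" and "C = exp z"
  have pos: "A \<ge> 1" "A > 0" "B > 0" "C > 0" using assms by (auto simp: A_def B_def C_def)
  have e: "exp (x + y + z) = A * B * C" by (simp add: A_def B_def C_def exp_add)
  have D: "(A * B * C) * A - B * C = (A\<^sup>2 - 1) * (B * C)"
    by (simp add: power2_eq_square algebra_simps)
  have n: "(A\<^sup>2 - 1) * (B * C) \<ge> 0" using pos by (simp add: one_le_power)
  have k: "1 - exp (- 2 * x) = (A\<^sup>2 - 1) / A\<^sup>2"
    using pos by (simp add: A_def exp_minus exp_double diff_divide_distrib inverse_eq_divide)
  have l: "logistic (x + z) = A * C / (A * C + 1)" "logistic (x + y) = A * B / (A * B + 1)"
    "logistic (x - y) = A / (A + B)" "logistic (x - z) = A / (A + C)"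
    using pos by (simp_all add: logistic_def A_def B_def C_def exp_minus exp_add exp_diff
        divide_simps add_pos_pos)
  \<comment> \<open>Here \<open>B\<close> and \<open>C\<close> are fresh variables shadowing the
    constants, because the second quotient needs the same identity with their roles
    exchanged.\<close>
  have fac: "n / (B * (A * C + 1) * (A + B)) = (A\<^sup>2 - 1) / A\<^sup>2 * (A * C / (A * C + 1) * (A / (A + B)))"
    if "n = (A\<^sup>2 - 1) * (B * C)" "B > 0" "C > 0" for n B C
  proof -
    have "A * C + 1 \<noteq> 0" "A + B \<noteq> 0" 
      using that pos by (smt (verit) mult_pos_pos)+
    then show ?thesis using that pos by (simp add: divide_simps power2_eq_square)
  qed
  have "margin_weight x (y, z) = ((A\<^sup>2 - 1) * (B * C)) /
      min ((A * B * C + B) * (B + A)) ((A * B * C + C) * (C + A))"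
    using n by (simp add: margin_weight_eq lewontin_D'_def lewontin_Dmax_def lewontin_D_def
        row_margin_def col_margin_def sum_2 e D flip: A_def B_def C_def)
  also have "\<dots> = ((A\<^sup>2 - 1) * (B * C)) /
      min (B * (A * C + 1) * (A + B)) (C * (A * B + 1) * (A + C))"
    by (simp add: algebra_simps)
  also have "\<dots> = max ((A\<^sup>2 - 1) / A\<^sup>2 * (A * C / (A * C + 1) * (A / (A + B))))
     ((A\<^sup>2 - 1) / A\<^sup>2 * (A * B / (A * B + 1) * (A / (A + C))))"
    using pos n
    by (subst divide_min_eq_max) (simp_all add: add_pos_pos fac mult.commute[of B C] fac)
  also have "\<dots> = (A\<^sup>2 - 1) / A\<^sup>2 * 
     max (A * C / (A * C + 1) * (A / (A + B))) (A * B / (A * B + 1) * (A / (A + C)))"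
    using pos by (subst max_mult_distrib_left) (simp add: one_le_power)
  finally show ?thesis unfolding k l .
qed

lemma margin_weight_x_nonpos:
  assumes "x \<le> 0"
  shows "margin_weight x (y, z) =
    (exp (2 * x) - 1) *
      max (logistic (z - x) * logistic (y - x)) (logistic (- x - y) * logistic (- x - z))"
  using margin_weight_reflect[of "- x" "- y" z] margin_weight_x_nonneg[of "- x" "- y" z] assms
  by (simp add: algebra_simps)

lemma margin_weight_commute: "margin_weight x (y, z) = margin_weight x (z, y)"
  by (cases "x \<ge> 0") (simp_all add: margin_weight_x_nonneg margin_weight_x_nonpos max.commute mult.commute)

lemma margin_weight_positive: "x > 0 \<Longrightarrow> margin_weight x (y, z) > 0"
  by (simp add: margin_weight_x_nonneg less_max_iff_disj logistic_pos)

lemma margin_weight_negative: "x < 0 \<Longrightarrow> margin_weight x (y, z) < 0"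
  using margin_weight_positive[of "- x" "- y" z] by (simp add: margin_weight_reflect)

section \<open>Non-differentiability along the diagonals\<close>

text \<open>Used contrapositively: a kink along a single line through \<open>p\<close> rules out
  differentiability at \<open>p\<close>.\<close>

lemma differentiable_along_line:
  assumes "f differentiable (at p)"
  shows "(\<lambda>s::real. f (p + s *\<^sub>R v)) differentiable (at 0)"
proof -
  have "(\<lambda>s::real. p + s *\<^sub>R v) differentiable (at 0)"
    by (intro derivative_intros)
  then show ?thesis
    using differentiable_chain_at[of "\<lambda>s::real. p + s *\<^sub>R v" 0 f] assms by (simp add: o_def)
qed

text \<open>Both \<open>u\<close> and its mirror image lie below the maximum and touch it at 0, so a
  derivative of the maximum there would have to equal both \<open>d\<close> and
  \<open>- d\<close>.\<close>

lemma max_mirror_not_differentiable: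
  fixes u :: "real \<Rightarrow> real"
  assumes u: "(u has_real_derivative d) (at 0)" and "d \<noteq> 0"
  shows "\<not> (\<lambda>s. max (u s) (u (- s))) differentiable (at 0)"
proof
  assume "(\<lambda>s. max (u s) (u (- s))) differentiable (at 0)"
  then obtain e where e: "((\<lambda>s. max (u s) (u (- s))) has_real_derivative e) (at 0)"
    using real_differentiable_def by blast
  have u': "((\<lambda>s. u (- s)) has_real_derivative - d) (at 0)"
    using DERIV_mirror[of u d 0] u by simp
  have "e - d = 0"
    by (rule DERIV_local_min[OF DERIV_diff[OF e u], of 1]) auto
  moreover have "e - - d = 0"
    by (rule DERIV_local_min[OF DERIV_diff[OF e u'], of 1]) auto
  ultimately show False using \<open>d \<noteq> 0\<close> by simp
qed

text \<open>On this line, perpendicular to the diagonal, replacing \<open>s\<close> by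
  \<open>- s\<close> exchanges the two products. Both factors of \<open>u\<close> increase in
  \<open>s\<close>, which makes its slope at 0 positive.\<close>

lemma margin_weight_diagonal_kink:
  assumes "x > 0"
  shows "\<not> (\<lambda>s. margin_weight x (a + s, a - s)) differentiable (at 0)"
proof -
  define k where "k = 1 - exp (- 2 * x)"
  have k: "k > 0" using assms by (simp add: k_def)
  define u where "u s = k * (logistic (x + a + s) * logistic (x - a + s))" for s
  have "margin_weight x (a + s, a - s) = max (u s) (u (- s))" for s
  proof -
    have "x + (a - s) = x + a + - s" "x - (a + s) = x - a + - s" "x + (a + s) = x + a + s"
      "x - (a - s) = x - a + s"
      by simp_all
    then show ?thesis
      using assms k by (simp only: margin_weight_x_nonneg less_imp_le u_def max_mult_distrib_left
          max.commute if_True flip: k_def)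
  qed
  then have eq: "(\<lambda>s. margin_weight x (a + s, a - s)) = (\<lambda>s. max (u s) (u (- s)))" by simp
  define d where "d = k * (logistic (x + a) * (1 - logistic (x + a)) * logistic (x - a)
    + logistic (x + a) * (logistic (x - a) * (1 - logistic (x - a))))"
  have "(u has_real_derivative d) (at 0)"
    unfolding u_def d_def by (auto intro!: derivative_eq_intros simp: algebra_simps)
  moreover have "d > 0"
    unfolding d_def using k by (intro mult_pos_pos add_pos_pos) (auto simp: logistic_pos logistic_less_1)
  ultimately show ?thesis
    unfolding eq using max_mirror_not_differentiable by force
qed

lemma margin_weight_not_differentiable_pos:
  assumes "x > 0"
  shows "\<not> margin_weight x differentiable (at (y, y))"
  using differentiable_along_line[of "margin_weight x" "(y, y)" "(1, -1)"]
    margin_weight_diagonal_kink[OF assms, of y] by auto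

lemma margin_weight_not_differentiable_neg:
  assumes "x < 0"
  shows "\<not> margin_weight x differentiable (at (y, - y))"
proof
  assume "margin_weight x differentiable (at (y, - y))"
  \<comment> \<open>With this direction, negating the first coordinate turns the line into
    \<open>(a + s, a - s)\<close> for \<open>a = - y\<close>, so the kink for \<open>- x\<close>
    applies.\<close>
  from differentiable_along_line[OF this, of "(- 1, - 1)"]
  have "(\<lambda>s. - margin_weight x (y - s, - y - s)) differentiable (at 0)" by auto
  moreover have "- margin_weight x (y - s, - y - s) = margin_weight (- x) (- y + s, - y - s)" for s
    using margin_weight_reflect[of x "y - s" "- y - s"] by simp
  ultimately show False
    using margin_weight_diagonal_kink[of "- x" "- y"] assms by simp
qed

section \<open>The saddle point at the origin\<close>

text \<open>After taking reciprocals and expanding, the two sides differ only in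
  \<open>A * (E + 1 / E)\<close> against \<open>A * 2\<close>, and \<open>E + 1 / E > 2\<close> for
  positive \<open>E\<close> other than 1.\<close>

lemma logistic_mult_less:
  assumes "s \<noteq> 0"
  shows "logistic (x + s) * logistic (x - s) < logistic x * logistic x"
proof -
  define A E where "A = exp (- x)" and "E = exp s"
  have pos: "A > 0" "E > 0" by (simp_all add: A_def E_def)
  have "(E - 1)\<^sup>2 > 0" using assms by (simp add: E_def)
  then have "2 < E + 1 / E"
    using pos by (simp add: field_simps power2_eq_square)
  then have "A * 2 < A * (E + 1 / E)" using pos by simp
  then have *: "(1 + A) * (1 + A) < (1 + A / E) * (1 + A * E)"
    using pos by (simp add: algebra_simps)
  have "exp (- (x + s)) = A / E" "exp (- (x - s)) = A * E"
    by (simp_all add: A_def E_def exp_minus exp_add exp_diff field_simps)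
  then show ?thesis
    using pos * unfolding logistic_def A_def[symmetric]
    by (simp add: add_pos_pos flip: inverse_mult_distrib)
qed

lemma margin_weight_main_diagonal:
  assumes "s \<noteq> 0" "x > 0"
  shows "margin_weight x (s, s) < margin_weight x (0, 0)"
  using assms logistic_mult_less[of s x] by (simp add: margin_weight_x_nonneg)

text \<open>The two products are the squares of \<open>logistic (x - s)\<close> and
  \<open>logistic (x + s)\<close>; the larger one is the square at
  \<open>x + \<bar>s\<bar>\<close>.\<close>

lemma margin_weight_antidiagonal:
  assumes "s \<noteq> 0" "x > 0"
  shows "margin_weight x (s, - s) > margin_weight x (0, 0)"
proof -
  have "logistic x * logistic x < logistic (x + \<bar>s\<bar>) * logistic (x + \<bar>s\<bar>)"
    using assms by (intro mult_strict_mono) (auto simp: logistic_pos less_imp_le)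
  also have "\<dots> \<le> max (logistic (x + - s) * logistic (x - s)) (logistic (x + s) * logistic (x - - s))"
    by (cases "s \<ge> 0") auto
  finally show ?thesis using assms by (simp add: margin_weight_x_nonneg)
qed

text \<open>The reflection exchanges the two diagonals and also flips the sign, so for either sign
  of \<open>x\<close> the maximum lies along \<open>y = z\<close> and the minimum along
  \<open>y = - z\<close>.\<close>

lemma margin_weight_saddle:
  assumes "x \<noteq> 0"
  shows "nonsmooth_saddle_point (margin_weight x) (0, 0)"
proof -
  have nd: "\<not> margin_weight x differentiable (at (0, 0))"
    using margin_weight_not_differentiable_pos[of x 0] margin_weight_not_differentiable_neg[of x 0] assms
    by (cases "x > 0") auto
  have less: "margin_weight x (s, s) < margin_weight x (0, 0)" if "s \<noteq> 0" for s
    using margin_weight_main_diagonal[of s x] margin_weight_antidiagonal[of "- s" "- x"] that assms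
      margin_weight_reflect[of x s s] margin_weight_reflect[of x 0 0]
    by (cases "x > 0") auto
  have greater: "margin_weight x (s, - s) > margin_weight x (0, 0)" if "s \<noteq> 0" for s
    using margin_weight_antidiagonal[of s x] margin_weight_main_diagonal[of "- s" "- x"] that assms
      margin_weight_reflect[of x s "- s"] margin_weight_reflect[of x 0 0]
    by (cases "x > 0") auto
  have ne: "line_through (0, 0) (1, 1) \<noteq> line_through (0, 0) (1, - 1)"
  proof
    assume "line_through (0, 0) (1, 1) = line_through (0, 0) (1, - 1)"
    moreover have "(1, 1) \<in> line_through (0, 0) (1, 1)"
      unfolding line_through_def by (auto intro: image_eqI[where x = 1])
    ultimately show False by (auto simp: line_through_def)
  qed
  have max_line: "\<forall>\<^sub>F q in at (0, 0) within line_through (0, 0) (1, 1).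
      margin_weight x q < margin_weight x (0, 0)"
    unfolding eventually_at_filter
    by (intro always_eventually) (auto simp: line_through_def intro: less)
  have min_line: "\<forall>\<^sub>F q in at (0, 0) within line_through (0, 0) (1, - 1).
      margin_weight x q > margin_weight x (0, 0)"
    unfolding eventually_at_filter
    by (intro always_eventually) (auto simp: line_through_def intro: greater)
  have "(1, 1) \<noteq> (0 :: real \<times> real)" "(1, - 1) \<noteq> (0 :: real \<times> real)"
    by (simp_all add: zero_prod_def)
  then show ?thesis
    unfolding nonsmooth_saddle_point_def using nd ne max_line min_line by blast
qed

section \<open>Limits in \<open>y\<close> and \<open>z\<close>, and the ranges of the limit
  functions\<close>

text \<open>One function serves all four limits: \<open>w\<close> is the remaining coordinate for a
  limit at \<open>\<infinity>\<close> and its negative for a limit at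
  \<open>- \<infinity>\<close>.\<close>

definition margin_limit :: "real \<Rightarrow> real \<Rightarrow> real" where
  "margin_limit x w = (exp (2 * x) - 1) *
    (if x > 0 then inverse (exp (2 * x) + exp (x + w)) else inverse (exp (x - w) + 1))"

lemma margin_limit_pos:
  assumes "x > 0"
  shows "margin_limit x w = (1 - exp (- 2 * x)) * logistic (x - w)"
proof -
  have "exp (2 * x) + exp (x + w) = exp (2 * x) * (1 + exp (- (x - w)))"
    by (simp add: algebra_simps flip: exp_add)
  moreover have "exp (2 * x) - 1 = exp (2 * x) * (1 - exp (- 2 * x))"
    by (simp add: algebra_simps flip: exp_add)
  ultimately show ?thesis
    using assms by (simp add: margin_limit_def logistic_def)
qed

lemma margin_limit_neg: "x < 0 \<Longrightarrow> margin_limit x w = (exp (2 * x) - 1) * logistic (w - x)"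
  by (simp add: margin_limit_def logistic_def add.commute)

lemma logistic_add_at_top: "((\<lambda>u. logistic (c + u)) \<longlongrightarrow> 1) at_top"
  and logistic_add_at_bot: "((\<lambda>u. logistic (c + u)) \<longlongrightarrow> 0) at_bot"
  and logistic_diff_at_top: "((\<lambda>u. logistic (c - u)) \<longlongrightarrow> 0) at_top"
  and logistic_diff_at_bot: "((\<lambda>u. logistic (c - u)) \<longlongrightarrow> 1) at_bot"
  and logistic_rdiff_at_top: "((\<lambda>u. logistic (u - c)) \<longlongrightarrow> 1) at_top"
  and logistic_rdiff_at_bot: "((\<lambda>u. logistic (u - c)) \<longlongrightarrow> 0) at_bot"
  unfolding logistic_def by real_asymp+

lemmas logistic_limits = logistic_add_at_top logistic_add_at_bot logistic_diff_at_top
  logistic_diff_at_bot logistic_rdiff_at_top logistic_rdiff_at_bot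

text \<open>In each limit in \<open>y\<close> one of the two products tends to 0, and the maximum
  collapses to the other.\<close>

lemma max_logistic_0 [simp]: "max (logistic u) 0 = logistic u" "max 0 (logistic u) = logistic u"
  using logistic_pos[of u] by auto

lemma margin_weight_y_at_top:
  assumes "x \<noteq> 0"
  shows "((\<lambda>y. margin_weight x (y, z)) \<longlongrightarrow> margin_limit x z) at_top"
proof (cases "x > 0")
  case True
  have "((\<lambda>y. margin_weight x (y, z)) \<longlongrightarrow> (1 - exp (- 2 * x)) *
      max (logistic (x + z) * 0) (1 * logistic (x - z))) at_top"
    using True unfolding margin_weight_x_nonneg[OF less_imp_le[OF True]]
    by (intro tendsto_intros tendsto_max logistic_limits)
  then show ?thesis using True by (simp add: margin_limit_pos)
next
  case False
  then have x: "x < 0" using assms by simp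
  have "((\<lambda>y. margin_weight x (y, z)) \<longlongrightarrow> (exp (2 * x) - 1) *
      max (logistic (z - x) * 1) (0 * logistic (- x - z))) at_top"
    unfolding margin_weight_x_nonpos[OF less_imp_le[OF x]]
    by (intro tendsto_intros tendsto_max logistic_limits)
  then show ?thesis using x by (simp add: margin_limit_neg)
qed

lemma margin_weight_y_at_bot:
  assumes "x \<noteq> 0"
  shows "((\<lambda>y. margin_weight x (y, z)) \<longlongrightarrow> margin_limit x (- z)) at_bot"
proof (cases "x > 0")
  case True
  have "((\<lambda>y. margin_weight x (y, z)) \<longlongrightarrow> (1 - exp (- 2 * x)) *
      max (logistic (x + z) * 1) (0 * logistic (x - z))) at_bot"
    unfolding margin_weight_x_nonneg[OF less_imp_le[OF True]]
    by (intro tendsto_intros tendsto_max logistic_limits)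
  then show ?thesis using True by (simp add: margin_limit_pos)
next
  case False
  then have x: "x < 0" using assms by simp
  have "((\<lambda>y. margin_weight x (y, z)) \<longlongrightarrow> (exp (2 * x) - 1) *
      max (logistic (z - x) * 0) (1 * logistic (- x - z))) at_bot"
    unfolding margin_weight_x_nonpos[OF less_imp_le[OF x]]
    by (intro tendsto_intros tendsto_max logistic_limits)
  then show ?thesis using x by (simp add: margin_limit_neg minus_diff_commute)
qed

lemma range_scaled_logistic:
  assumes "surj e" "c \<noteq> 0"
  shows "range (\<lambda>w. c * logistic (e w)) = (if c > 0 then {0<..<c} else {c<..<0})"
proof -
  have "range (\<lambda>w. c * logistic (e w)) = (*) c ` logistic ` range e"
    by (simp add: image_image)
  also have "\<dots> = (*) c ` {0<..<1}"
    using assms(1) range_logistic by simp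
  also have "\<dots> = (if c > 0 then {0<..<c} else {c<..<0})"
  proof (intro equalityI subsetI)
    fix p assume "p \<in> (if c > 0 then {0<..<c} else {c<..<0})"
    then have "p / c \<in> {0<..<1}" "p = c * (p / c)"
      using assms(2) by (auto simp: field_simps split: if_splits)
    then show "p \<in> (*) c ` {0<..<1}" by blast
  qed (use assms(2) in \<open>auto simp: mult_less_0_iff zero_less_mult_iff\<close>)
  finally show ?thesis .
qed

lemma range_margin_limit:
  assumes "x \<noteq> 0"
  shows "range (margin_limit x) =
    (if x > 0 then {0 <..< 1 - exp (- 2 * x)} else {exp (2 * x) - 1 <..< 0})"
proof (cases "x > 0")
  case True
  have "surj (\<lambda>w. x - w)" by (rule surjI[of _ "\<lambda>w. x - w"]) simp
  from range_scaled_logistic[OF this, of "1 - exp (- 2 * x)"] show ?thesis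
    using True margin_limit_pos[OF True] by simp
next
  case False
  then have x: "x < 0" using assms by simp
  have "surj (\<lambda>w. w - x)" by (rule surjI[of _ "\<lambda>w. w + x"]) simp
  from range_scaled_logistic[OF this, of "exp (2 * x) - 1"] show ?thesis
    using x margin_limit_neg[OF x] by simp
qed

lemma margin_limit_tendsto_0:
  "x > 0 \<Longrightarrow> (margin_limit x \<longlongrightarrow> 0) at_top"
  "x < 0 \<Longrightarrow> (margin_limit x \<longlongrightarrow> 0) at_bot"
proof -
  assume x: "x > 0"
  have "((\<lambda>w. (1 - exp (- 2 * x)) * logistic (x - w)) \<longlongrightarrow> (1 - exp (- 2 * x)) * 0) at_top"
    by (intro tendsto_intros logistic_limits)
  moreover have "margin_limit x = (\<lambda>w. (1 - exp (- 2 * x)) * logistic (x - w))"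
    by (intro ext margin_limit_pos x)
  ultimately show "(margin_limit x \<longlongrightarrow> 0) at_top" by simp
next
  assume x: "x < 0"
  have "((\<lambda>w. (exp (2 * x) - 1) * logistic (w - x)) \<longlongrightarrow> (exp (2 * x) - 1) * 0) at_bot"
    by (intro tendsto_intros logistic_limits)
  moreover have "margin_limit x = (\<lambda>w. (exp (2 * x) - 1) * logistic (w - x))"
    by (intro ext margin_limit_neg x)
  ultimately show "(margin_limit x \<longlongrightarrow> 0) at_bot" by simp
qed

lemma margin_weight_joint_pos:
  assumes "x > 0" "F = at_top \<or> F = at_bot"
  shows "(margin_weight x \<longlongrightarrow> 0) (F \<times>\<^sub>F F)"
proof -
  have eq: "margin_weight x = (\<lambda>p. (1 - exp (- 2 * x)) *
      max (logistic (x + snd p) * logistic (x - fst p)) (logistic (x + fst p) * logistic (x - snd p)))"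
    using assms by (auto simp: fun_eq_iff margin_weight_x_nonneg)
  \<comment> \<open>In either direction one of the limits is 0 and the other is 1; each product
    pairs one factor of each kind, so both tend to \<open>a * b\<close>.\<close>
  have "\<exists>a b. a * b = 0 \<and> ((\<lambda>u. logistic (x + u)) \<longlongrightarrow> a) F \<and> ((\<lambda>u. logistic (x - u)) \<longlongrightarrow> b) F"
    using assms(2) logistic_limits[of x]
    by (metis mult_zero_left mult_zero_right)
  then obtain a b where ab: "a * b = 0" "((\<lambda>u. logistic (x + u)) \<longlongrightarrow> a) F"
    "((\<lambda>u. logistic (x - u)) \<longlongrightarrow> b) F" by blast
  note lims = ab(2,3)[THEN filterlim_compose, OF filterlim_fst]
    ab(2,3)[THEN filterlim_compose, OF filterlim_snd]
  have "(margin_weight x \<longlongrightarrow> (1 - exp (- 2 * x)) * max (a * b) (a * b)) (F \<times>\<^sub>F F)"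
    unfolding eq by (intro tendsto_intros tendsto_max lims)
  then show ?thesis using ab(1) by simp
qed

lemma margin_weight_joint_neg:
  assumes "x < 0" "(F, G) = (at_top, at_bot) \<or> (F, G) = (at_bot, at_top)"
  shows "(margin_weight x \<longlongrightarrow> 0) (F \<times>\<^sub>F G)"
proof -
  have eq: "margin_weight x = (\<lambda>p. (exp (2 * x) - 1) *
      max (logistic (snd p - x) * logistic (fst p - x)) (logistic (- x - fst p) * logistic (- x - snd p)))"
    using assms by (auto simp: fun_eq_iff margin_weight_x_nonpos)
  \<comment> \<open>As \<open>F\<close> and \<open>G\<close> point in opposite directions,
    \<open>a\<close> and \<open>b\<close> change places between them, and each product again pairs
    \<open>a\<close> with \<open>b\<close>.\<close>
  have "\<exists>a b. a * b = 0 \<and> ((\<lambda>u. logistic (u - x)) \<longlongrightarrow> a) F \<and> ((\<lambda>u. logistic (u - x)) \<longlongrightarrow> b) G \<and>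
      ((\<lambda>u. logistic (- x - u)) \<longlongrightarrow> b) F \<and> ((\<lambda>u. logistic (- x - u)) \<longlongrightarrow> a) G"
    using assms(2) logistic_rdiff_at_top[of x] logistic_rdiff_at_bot[of x]
      logistic_diff_at_top[of "- x"] logistic_diff_at_bot[of "- x"]
    by (metis mult_zero_left mult_zero_right prod.inject)
  then obtain a b where ab: "a * b = 0"
    and F: "((\<lambda>u. logistic (u - x)) \<longlongrightarrow> a) F" "((\<lambda>u. logistic (- x - u)) \<longlongrightarrow> b) F"
    and G: "((\<lambda>u. logistic (u - x)) \<longlongrightarrow> b) G" "((\<lambda>u. logistic (- x - u)) \<longlongrightarrow> a) G"
    by blast
  note lims = F[THEN filterlim_compose, OF filterlim_fst] G[THEN filterlim_compose, OF filterlim_snd]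
  have "(margin_weight x \<longlongrightarrow> (exp (2 * x) - 1) * max (b * a) (b * a)) (F \<times>\<^sub>F G)"
    unfolding eq by (intro tendsto_intros tendsto_max lims)
  then show ?thesis using ab by (simp add: mult.commute)
qed

section \<open>Limits in \<open>x\<close>\<close>

lemma margin_weight_x_at_top: "((\<lambda>x. margin_weight x (y, z)) \<longlongrightarrow> 1) at_top"
proof -
  have add: "((\<lambda>x. logistic (x + c)) \<longlongrightarrow> 1) at_top" for c
    unfolding logistic_def by real_asymp
  have k: "((\<lambda>x::real. 1 - exp (- 2 * x)) \<longlongrightarrow> 1) at_top" by real_asymp
  have "((\<lambda>x. (1 - exp (- 2 * x)) * max (logistic (x + z) * logistic (x - y))
      (logistic (x + y) * logistic (x - z))) \<longlongrightarrow> 1 * max (1 * 1) (1 * 1)) at_top"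
    by (intro tendsto_mult tendsto_max k add logistic_limits)
  moreover have "\<forall>\<^sub>F x in at_top. (1 - exp (- 2 * x)) * max (logistic (x + z) * logistic (x - y))
      (logistic (x + y) * logistic (x - z)) = margin_weight x (y, z)"
    using eventually_ge_at_top[of 0] by eventually_elim (simp add: margin_weight_x_nonneg)
  ultimately show ?thesis by (simp add: tendsto_cong)
qed

lemma margin_weight_x_at_bot: "((\<lambda>x. margin_weight x (y, z)) \<longlongrightarrow> - 1) at_bot"
  using tendsto_minus[OF margin_weight_x_at_top[of "- y" z]]
    margin_weight_reflect[of _ "- y" z]
  by (simp add: filterlim_at_bot_mirror)

section \<open>Continuous extension to the compactified cube\<close>

definition elogistic :: "ereal \<Rightarrow> real" where
  "elogistic u = (if u = \<infinity> then 1 else if u = - \<infinity> then 0 else logistic (real_of_ereal u))"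

lemma elogistic_simps [simp]:
  "elogistic (ereal r) = logistic r" "elogistic \<infinity> = 1" "elogistic (- \<infinity>) = 0"
  by (simp_all add: elogistic_def)

lemma elogistic_nonneg: "0 \<le> elogistic u"
  and elogistic_le_1: "elogistic u \<le> 1"
  by (cases u; simp add: logistic_pos logistic_less_1 less_imp_le)+

text \<open>Keeps the denominator of \<open>x_factor\<close> away from 0 on the half with
  \<open>x \<ge> 0\<close>.\<close>

lemma elogistic_ge_half: "0 \<le> u \<Longrightarrow> 1 / 2 \<le> elogistic u"
proof (cases u)
  case (real r)
  moreover assume "0 \<le> u"
  ultimately have "logistic 0 \<le> logistic r" by (subst logistic_le_iff) simp
  then show ?thesis using real by (simp add: logistic_def)
qed auto

lemma isCont_elogistic: "isCont elogistic u"
proof -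
  have "(elogistic \<longlongrightarrow> elogistic u) (at u)"
  proof (cases u)
    case (real r)
    have "(logistic \<longlongrightarrow> logistic r) (at r)"
      using DERIV_logistic[OF DERIV_ident, of r UNIV] DERIV_isCont isCont_def by blast
    then show ?thesis
      unfolding real at_ereal by (simp add: filterlim_filtermap)
  next
    case PInf
    \<comment> \<open>Nothing lies beyond \<open>\<infinity>\<close>, so its neighbourhood filter is
      one-sided and is the image of \<open>at_top\<close>.\<close>
    have "{\<infinity>::ereal<..} = {}" by auto
    then have "at (\<infinity>::ereal) = filtermap ereal at_top"
      by (simp add: at_eq_sup_left_right at_left_PInf)
    then show ?thesis
      using logistic_at_top by (simp add: PInf filterlim_filtermap)
  next
    case MInf
    have "{..<- \<infinity>::ereal} = {}" by auto
    then have "at (- \<infinity>::ereal) = filtermap ereal at_bot"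
      by (simp add: at_eq_sup_left_right at_right_MInf)
    then show ?thesis
      using logistic_at_bot by (simp add: MInf filterlim_filtermap)
  qed
  then show ?thesis by (simp add: isCont_def)
qed

lemmas tendsto_elogistic = isCont_tendsto_compose[OF isCont_elogistic]

(* The factor 1 - exp (- 2 * x), written in terms of elogistic x so that it extends to x = \<infinity>. *)
definition x_factor :: "ereal \<Rightarrow> real" where
  "x_factor x = (2 * elogistic x - 1) / (elogistic x)\<^sup>2"

text \<open>With \<open>e = exp (- x)\<close> the quotient simplifies to
  \<open>(1 - e) * (1 + e)\<close>.\<close>

lemma x_factor_ereal: "x_factor (ereal x) = 1 - exp (- 2 * x)"
proof -
  have "1 + exp (- x) > 0" "exp (- 2 * x) = (exp (- x))\<^sup>2"
    by (simp_all add: add_pos_pos exp_double[symmetric])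
  then show ?thesis
    by (simp add: x_factor_def logistic_def field_simps power2_eq_square)
qed

lemma x_factor_tendsto:
  assumes "(X \<longlongrightarrow> x) F" "x \<ge> 0"
  shows "((\<lambda>t. x_factor (X t)) \<longlongrightarrow> x_factor x) F"
  unfolding x_factor_def using elogistic_ge_half[OF assms(2)]
  by (intro tendsto_intros tendsto_elogistic assms(1)) auto

text \<open>Meant for \<open>x \<ge> 0\<close>. Where a sum or difference is indeterminate,
  \<open>ereal\<close> arithmetic still assigns a value; off \<open>V_g\<close> it cannot affect the
  maximum, because the other product is then 1.\<close>

definition weight_ext0 :: "ereal \<Rightarrow> ereal \<Rightarrow> ereal \<Rightarrow> real" where
  "weight_ext0 x y z = x_factor x *
    max (elogistic (x + z) * elogistic (x - y)) (elogistic (x + y) * elogistic (x - z))"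

lemma weight_ext0_ereal:
  "x \<ge> 0 \<Longrightarrow> weight_ext0 (ereal x) (ereal y) (ereal z) = margin_weight x (y, z)"
  by (simp add: weight_ext0_def x_factor_ereal margin_weight_x_nonneg)

text \<open>The maximum is squeezed between \<open>P\<close> and 1, however \<open>Q\<close>
  oscillates. This covers a product with an indeterminate argument.\<close>

lemma max_tendsto_1:
  fixes P Q :: "'a \<Rightarrow> real"
  assumes "(P \<longlongrightarrow> 1) F" "\<And>t. P t \<le> 1" "\<And>t. Q t \<le> 1"
  shows "((\<lambda>t. max (P t) (Q t)) \<longlongrightarrow> 1) F" "((\<lambda>t. max (Q t) (P t)) \<longlongrightarrow> 1) F"
  by (rule tendsto_sandwich[OF _ _ assms(1) tendsto_const]; simp add: assms)+

lemma weight_ext0_tendsto: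
  assumes X: "(X \<longlongrightarrow> x) F" and Y: "(Y \<longlongrightarrow> y) F" and Z: "(Z \<longlongrightarrow> z) F"
    and x: "x \<ge> 0" and V: "(x, y, z) \<notin> V_g"
  shows "((\<lambda>t. weight_ext0 (X t) (Y t) (Z t)) \<longlongrightarrow> weight_ext0 x y z) F"
proof -
  let ?P = "\<lambda>x y z. elogistic (x + z) * elogistic (x - y)"
  have le_1: "?P x y z \<le> 1" for x y z
    by (intro mult_le_one elogistic_nonneg elogistic_le_1)
  have P: "((\<lambda>t. ?P (X t) (Y t) (Z t)) \<longlongrightarrow> ?P x y z) F"
    if "x = \<infinity> \<Longrightarrow> z \<noteq> - \<infinity> \<and> y \<noteq> \<infinity>"
      "(Y \<longlongrightarrow> y) F" "(Z \<longlongrightarrow> z) F" for Y Z y z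
    using that x by (intro tendsto_mult tendsto_elogistic tendsto_add_ereal_general
        tendsto_diff_ereal_general X) auto
  have max: "((\<lambda>t. max (?P (X t) (Y t) (Z t)) (?P (X t) (Z t) (Y t))) \<longlongrightarrow>
      max (?P x y z) (?P x z y)) F"
  proof (cases "x = \<infinity>")
    case False
    then show ?thesis by (intro tendsto_max P Y Z) auto
  next
    case True
    \<comment> \<open>The two disjuncts say that the first or the second product is determinate.
      Both fail only if \<open>y\<close> and \<open>z\<close> are the same infinity, which is a
      vertex in \<open>V_g\<close>.\<close>
    then have "(z \<noteq> - \<infinity> \<and> y \<noteq> \<infinity>) \<or> (y \<noteq> - \<infinity> \<and> z \<noteq> \<infinity>)"
      using V by (auto simp: V_g_def)
    then show ?thesis
    proof
      assume yz: "z \<noteq> - \<infinity> \<and> y \<noteq> \<infinity>"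
      then have 1: "?P x y z = 1" using True by (cases y; cases z) auto
      then have "((\<lambda>t. max (?P (X t) (Y t) (Z t)) (?P (X t) (Z t) (Y t))) \<longlongrightarrow> 1) F"
        using P[OF _ Y Z] yz by (intro max_tendsto_1(1) le_1) auto
      moreover have "max (?P x y z) (?P x z y) = 1"
        unfolding 1 by (rule max.absorb1[OF le_1])
      ultimately show ?thesis by simp
    next
      assume yz: "y \<noteq> - \<infinity> \<and> z \<noteq> \<infinity>"
      then have 1: "?P x z y = 1" using True by (cases y; cases z) auto
      then have "((\<lambda>t. max (?P (X t) (Y t) (Z t)) (?P (X t) (Z t) (Y t))) \<longlongrightarrow> 1) F"
        using P[OF _ Z Y] yz by (intro max_tendsto_1(2) le_1) auto
      moreover have "max (?P x y z) (?P x z y) = 1"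
        unfolding 1 by (rule max.absorb2[OF le_1])
      ultimately show ?thesis by simp
    qed
  qed
  then show ?thesis
    unfolding weight_ext0_def by (intro tendsto_mult x_factor_tendsto X x)
qed

definition weight_ext :: "ereal \<times> ereal \<times> ereal \<Rightarrow> real" where
  "weight_ext = (\<lambda>(x, y, z). if x \<ge> 0 then weight_ext0 x y z else - weight_ext0 (- x) (- y) z)"

lemma weight_ext_ereal:
  "weight_ext (ereal x, ereal y, ereal z) = margin_weight x (y, z)"
  using weight_ext0_ereal[of x y z] weight_ext0_ereal[of "- x" "- y" z]
  by (auto simp: weight_ext_def margin_weight_reflect)

lemma V_g_reflect: "(x, y, z) \<notin> V_g \<Longrightarrow> (- x, - y, z) \<notin> V_g"
  by (auto simp: V_g_def ereal_uminus_eq_reorder)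

lemma isCont_weight_ext:
  assumes "p \<notin> V_g"
  shows "isCont weight_ext p"
proof -
  obtain x y z where p: "p = (x, y, z)" by (metis prod_cases3)
  let ?F = "at p"
  have X: "(fst \<longlongrightarrow> x) ?F" and Y: "((\<lambda>q. fst (snd q)) \<longlongrightarrow> y) ?F"
    and Z: "((\<lambda>q. snd (snd q)) \<longlongrightarrow> z) ?F"
    by (auto simp: p intro!: tendsto_eq_intros)
  have eq: "weight_ext q = (if fst q \<ge> 0 then weight_ext0 (fst q) (fst (snd q)) (snd (snd q))
      else - weight_ext0 (- fst q) (- fst (snd q)) (snd (snd q)))" for q
    by (simp add: weight_ext_def case_prod_beta)
  have eq_neg: "weight_ext q = - weight_ext0 (- fst q) (- fst (snd q)) (snd (snd q))"
    if "fst q < 0" for q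
    unfolding eq using that by (meson not_less)
  have pos: "((\<lambda>q. weight_ext0 (fst q) (fst (snd q)) (snd (snd q))) \<longlongrightarrow> weight_ext0 x y z) ?F"
    if "x \<ge> 0"
    using weight_ext0_tendsto[OF X Y Z that] assms p by simp
  have neg: "((\<lambda>q. - weight_ext0 (- fst q) (- fst (snd q)) (snd (snd q))) \<longlongrightarrow>
      - weight_ext0 (- x) (- y) z) ?F" if "x \<le> 0"
    using that assms V_g_reflect p
    by (intro tendsto_minus weight_ext0_tendsto tendsto_uminus_ereal X Y Z) auto
  consider "x > 0" | "x < 0" | "x = 0" by force
  then have "(weight_ext \<longlongrightarrow> weight_ext (x, y, z)) ?F"
  proof cases
    case 1
    have "\<forall>\<^sub>F q in ?F. weight_ext0 (fst q) (fst (snd q)) (snd (snd q)) = weight_ext q"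
      using order_tendstoD(1)[OF X 1] by eventually_elim (simp only: eq less_imp_le if_True)
    moreover have "weight_ext (x, y, z) = weight_ext0 x y z"
      using 1 by (simp only: eq less_imp_le if_True fst_conv snd_conv)
    ultimately show ?thesis
      using Lim_transform_eventually[OF pos[OF less_imp_le[OF 1]]] by simp
  next
    case 2
    have "\<forall>\<^sub>F q in ?F. - weight_ext0 (- fst q) (- fst (snd q)) (snd (snd q)) = weight_ext q"
      using order_tendstoD(2)[OF X 2]
      by (rule eventually_mono) (rule eq_neg[symmetric])
    moreover have "weight_ext (x, y, z) = - weight_ext0 (- x) (- y) z"
      using eq_neg[of "(x, y, z)"] 2 by simp
    ultimately show ?thesis
      using Lim_transform_eventually[OF neg[OF less_imp_le[OF 2]]] by simp
  next
    case 3
    \<comment> \<open>On the plane \<open>x = 0\<close> this factor makes both branches tend to the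
      same value 0, even where \<open>y\<close> or \<open>z\<close> is infinite.\<close>
    have "x_factor 0 = 0" using x_factor_ereal[of 0] by (simp add: zero_ereal_def)
    then have 0: "weight_ext0 0 a b = 0" for a b by (simp add: weight_ext0_def)
    have lim0: "((\<lambda>q. weight_ext0 (fst q) (fst (snd q)) (snd (snd q))) \<longlongrightarrow> 0) ?F"
      "((\<lambda>q. - weight_ext0 (- fst q) (- fst (snd q)) (snd (snd q))) \<longlongrightarrow> 0) ?F"
      using pos neg 3 0 by simp_all
    have "((\<lambda>q. weight_ext q) \<longlongrightarrow> 0) ?F"
      unfolding eq
      by (intro filterlim_If) (rule tendsto_mono[OF inf_le1], rule lim0)+
    then show ?thesis using 3 0 by (simp add: weight_ext_def)
  qed
  then show ?thesis by (simp add: isCont_def p)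
qed

section \<open>Continuous extension to the closed tetrahedron\<close>

lemma closure_tables_nonneg: "t \<in> closure tables \<Longrightarrow> t $ i $ j \<ge> 0"
proof -
  assume t: "t \<in> closure tables"
  have "closed {t :: real^2^2. t $ i $ j \<ge> 0}"
    by (intro closed_Collect_le continuous_intros)
  then have "closure tables \<subseteq> {t. t $ i $ j \<ge> 0}"
    by (intro closure_minimal) (auto simp: tables_def less_imp_le)
  then show ?thesis using t by blast
qed

text \<open>A vanishing margin would force both of its nonnegative entries to vanish, placing the
  table on an edge.\<close>

lemma margins_pos:
  assumes "t \<in> closure tables - (table_edges \<union> table_vertices)"
  shows "row_margin t i > 0" "col_margin t i > 0"
proof -
  have nonneg: "t $ k $ l \<ge> 0" for k l using assms closure_tables_nonneg by blast
  have edge: "\<not> (t $ k $ l = 0 \<and> t $ m $ n = 0)" if "(k, l) \<noteq> (m, n)" for k l m n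
    using assms that unfolding table_edges_def by blast
  show "row_margin t i > 0"
    using edge[of i 1 i 2] nonneg[of i 1] nonneg[of i 2] by (force simp: row_margin_def sum_2)
  show "col_margin t i > 0"
    using edge[of 1 i 2 i] nonneg[of 1 i] nonneg[of 2 i] by (force simp: col_margin_def sum_2)
qed

(* Splitting D into its positive and negative parts removes the jump of Dmax at D = 0. *)
lemma lewontin_D'_split:
  "lewontin_D' t =
    max (lewontin_D t) 0 / min (row_margin t 1 * col_margin t 2) (col_margin t 1 * row_margin t 2) +
    min (lewontin_D t) 0 / min (row_margin t 1 * col_margin t 1) (row_margin t 2 * col_margin t 2)"
  by (simp add: lewontin_D'_def lewontin_Dmax_def)

lemma continuous_on_lewontin_D':
  "continuous_on (closure tables - (table_edges \<union> table_vertices)) lewontin_D'"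
proof -
  have "continuous_on S lewontin_D" "continuous_on S (\<lambda>t. row_margin t i)"
    "continuous_on S (\<lambda>t. col_margin t i)" for S i
    unfolding lewontin_D_def row_margin_def col_margin_def by (intro continuous_intros)+
  moreover have "min (row_margin t 1 * col_margin t 2) (col_margin t 1 * row_margin t 2) \<noteq> 0"
    "min (row_margin t 1 * col_margin t 1) (row_margin t 2 * col_margin t 2) \<noteq> 0"
    if "t \<in> closure tables - (table_edges \<union> table_vertices)" for t
    using margins_pos[OF that] by (simp_all add: min_def less_imp_neq[symmetric])
  ultimately show ?thesis
    unfolding lewontin_D'_split[abs_def]
    by (intro continuous_intros ballI) blast+
qed

theorem proposition7:
  shows
  "(\<forall>x::real. x \<noteq> 0 \<longrightarrow>
      \<comment> \<open>a)\<close>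
      (\<forall>y z. (margin_weight x (y, z) > 0 \<longleftrightarrow> x > 0) \<and> (margin_weight x (y, z) < 0 \<longleftrightarrow> x < 0)) \<and>
      (x > 0 \<longrightarrow> (\<forall>y. \<not> margin_weight x differentiable (at (y, y)))) \<and>
      (x < 0 \<longrightarrow> (\<forall>y. \<not> margin_weight x differentiable (at (y, - y)))) \<and>
      nonsmooth_saddle_point (margin_weight x) (0, 0) \<and>
      \<comment> \<open>b), the limit functions\<close>
      (\<forall>z. ((\<lambda>y. margin_weight x (y, z)) \<longlongrightarrow>
         (exp (2 * x) - 1) *
         (if x > 0 then inverse (exp (2 * x) + exp (x + z)) else inverse (exp (x - z) + 1))) at_top) \<and>
      (\<forall>z. ((\<lambda>y. margin_weight x (y, z)) \<longlongrightarrow>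
         (exp (2 * x) - 1) *
         (if x > 0 then inverse (exp (2 * x) + exp (x - z)) else inverse (exp (x + z) + 1))) at_bot) \<and>
      (\<forall>y. ((\<lambda>z. margin_weight x (y, z)) \<longlongrightarrow>
         (exp (2 * x) - 1) *
         (if x > 0 then inverse (exp (2 * x) + exp (x + y)) else inverse (exp (x - y) + 1))) at_top) \<and>
      (\<forall>y. ((\<lambda>z. margin_weight x (y, z)) \<longlongrightarrow>
         (exp (2 * x) - 1) *
         (if x > 0 then inverse (exp (2 * x) + exp (x - y)) else inverse (exp (x + y) + 1))) at_bot) \<and>
      \<comment> \<open>b), the ranges of the limit functions\<close>
      (\<forall>F \<in> {at_top, at_bot}.
         range (\<lambda>z. Lim F (\<lambda>y. margin_weight x (y, z))) =
           (if x > 0 then {0 <..< 1 - exp (- 2 * x)} else {exp (2 * x) - 1 <..< 0}) \<and>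
         range (\<lambda>y. Lim F (\<lambda>z. margin_weight x (y, z))) =
           (if x > 0 then {0 <..< 1 - exp (- 2 * x)} else {exp (2 * x) - 1 <..< 0})) \<and>
      \<comment> \<open>b), the limit 0, both as a joint limit and as a limit of the limit functions\<close>
      (\<forall>(F, G) \<in> (if x > 0 then {(at_top, at_top), (at_bot, at_bot)}
                   else {(at_top, at_bot), (at_bot, at_top)}).
         (margin_weight x \<longlongrightarrow> 0) (F \<times>\<^sub>F G) \<and>
         ((\<lambda>z. Lim F (\<lambda>y. margin_weight x (y, z))) \<longlongrightarrow> 0) G \<and>
         ((\<lambda>y. Lim G (\<lambda>z. margin_weight x (y, z))) \<longlongrightarrow> 0) F)) \<and>
   \<comment> \<open>c)\<close>
   (\<forall>y z. ((\<lambda>x. margin_weight x (y, z)) \<longlongrightarrow> 1) at_top \<and>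
          ((\<lambda>x. margin_weight x (y, z)) \<longlongrightarrow> - 1) at_bot) \<and>
   \<comment> \<open>d)\<close>
   (\<exists>f :: ereal \<times> ereal \<times> ereal \<Rightarrow> real.
      continuous_on (UNIV - V_g) f \<and>
      (\<forall>x y z. f (ereal x, ereal y, ereal z) = lewontin_D' (Psi x y z))) \<and>
   \<comment> \<open>e)\<close>
   (\<exists>f :: real^2^2 \<Rightarrow> real.
      continuous_on (closure tables - (table_edges \<union> table_vertices)) f \<and>
      (\<forall>t \<in> tables. f t = lewontin_D' t))"
proof (intro conjI allI impI)
  have top: "Lim at_top f = l" if "(f \<longlongrightarrow> l) at_top" for f :: "real \<Rightarrow> real" and l
    using that by (simp add: tendsto_Lim)
  have bot: "Lim at_bot f = l" if "(f \<longlongrightarrow> l) at_bot" for f :: "real \<Rightarrow> real" and l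
    using that by (simp add: tendsto_Lim)
  fix x :: real assume x: "x \<noteq> 0"
  have y_top: "((\<lambda>y. margin_weight x (y, z)) \<longlongrightarrow> margin_limit x z) at_top"
    and y_bot: "((\<lambda>y. margin_weight x (y, z)) \<longlongrightarrow> margin_limit x (- z)) at_bot" for z
    using margin_weight_y_at_top[OF x] margin_weight_y_at_bot[OF x] by auto
  have z_top: "((\<lambda>z. margin_weight x (y, z)) \<longlongrightarrow> margin_limit x y) at_top"
    and z_bot: "((\<lambda>z. margin_weight x (y, z)) \<longlongrightarrow> margin_limit x (- y)) at_bot" for y
    using y_top[of y] y_bot[of y] by (simp_all add: margin_weight_commute[of x y])
  note Lims = y_top[THEN top] y_bot[THEN bot] z_top[THEN top] z_bot[THEN bot]
  show "margin_weight x (y, z) > 0 \<longleftrightarrow> x > 0" "margin_weight x (y, z) < 0 \<longleftrightarrow> x < 0" for y z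
    using margin_weight_positive[of x y z] margin_weight_negative[of x y z] x by (cases "x > 0"; simp)+
  show "\<not> margin_weight x differentiable (at (y, y))" if "x > 0" for y
    using margin_weight_not_differentiable_pos that .
  show "\<not> margin_weight x differentiable (at (y, - y))" if "x < 0" for y
    using margin_weight_not_differentiable_neg that .
  show "nonsmooth_saddle_point (margin_weight x) (0, 0)"
    using margin_weight_saddle x .
  show "((\<lambda>y. margin_weight x (y, z)) \<longlongrightarrow> (exp (2 * x) - 1) *
      (if x > 0 then inverse (exp (2 * x) + exp (x + z)) else inverse (exp (x - z) + 1))) at_top" for z
    using y_top[of z] by (simp add: margin_limit_def)
  show "((\<lambda>y. margin_weight x (y, z)) \<longlongrightarrow> (exp (2 * x) - 1) *
      (if x > 0 then inverse (exp (2 * x) + exp (x - z)) else inverse (exp (x + z) + 1))) at_bot" for z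
    using y_bot[of z] by (cases "x > 0") (simp_all add: margin_limit_def)
  show "((\<lambda>z. margin_weight x (y, z)) \<longlongrightarrow> (exp (2 * x) - 1) *
      (if x > 0 then inverse (exp (2 * x) + exp (x + y)) else inverse (exp (x - y) + 1))) at_top" for y
    using z_top[of y] by (simp add: margin_limit_def)
  show "((\<lambda>z. margin_weight x (y, z)) \<longlongrightarrow> (exp (2 * x) - 1) *
      (if x > 0 then inverse (exp (2 * x) + exp (x - y)) else inverse (exp (x + y) + 1))) at_bot" for y
    using z_bot[of y] by (cases "x > 0") (simp_all add: margin_limit_def)
  have mirror: "range (\<lambda>w. margin_limit x (- w)) = range (margin_limit x)"
    using surj_uminus[where 'a = real] by (metis image_image)
  show "\<forall>F \<in> {at_top, at_bot}.
      range (\<lambda>z. Lim F (\<lambda>y. margin_weight x (y, z))) =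
        (if x > 0 then {0 <..< 1 - exp (- 2 * x)} else {exp (2 * x) - 1 <..< 0}) \<and>
      range (\<lambda>y. Lim F (\<lambda>z. margin_weight x (y, z))) =
        (if x > 0 then {0 <..< 1 - exp (- 2 * x)} else {exp (2 * x) - 1 <..< 0})"
    using range_margin_limit[OF x] mirror by (simp add: Lims)
  show "\<forall>(F, G) \<in> (if x > 0 then {(at_top, at_top), (at_bot, at_bot)}
        else {(at_top, at_bot), (at_bot, at_top)}).
      (margin_weight x \<longlongrightarrow> 0) (F \<times>\<^sub>F G) \<and>
      ((\<lambda>z. Lim F (\<lambda>y. margin_weight x (y, z))) \<longlongrightarrow> 0) G \<and>
      ((\<lambda>y. Lim G (\<lambda>z. margin_weight x (y, z))) \<longlongrightarrow> 0) F"
  proof (cases "x > 0")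
    case True
    \<comment> \<open>The limit functions at \<open>at_bot\<close> carry a negated argument, so
      reflecting the filter reduces them to the limit of \<open>margin_limit x\<close> at
      \<open>at_top\<close>.\<close>
    then show ?thesis
      using margin_weight_joint_pos[of x] margin_limit_tendsto_0(1)[of x]
      by (simp add: Lims filterlim_at_bot_mirror)
  next
    case False
    then have "x < 0" using x by simp
    then show ?thesis
      using margin_weight_joint_neg[of x] margin_limit_tendsto_0(2)[of x]
      by (simp add: Lims filterlim_at_bot_mirror)
  qed
next
  show "((\<lambda>x. margin_weight x (y, z)) \<longlongrightarrow> 1) at_top"
    "((\<lambda>x. margin_weight x (y, z)) \<longlongrightarrow> - 1) at_bot" for y z
    by (rule margin_weight_x_at_top margin_weight_x_at_bot)+
next
  show "\<exists>f :: ereal \<times> ereal \<times> ereal \<Rightarrow> real.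
      continuous_on (UNIV - V_g) f \<and>
      (\<forall>x y z. f (ereal x, ereal y, ereal z) = lewontin_D' (Psi x y z))"
    by (intro exI[of _ weight_ext] conjI continuous_at_imp_continuous_on ballI isCont_weight_ext)
      (auto simp: weight_ext_ereal margin_weight_def)
next
  show "\<exists>f :: real^2^2 \<Rightarrow> real.
      continuous_on (closure tables - (table_edges \<union> table_vertices)) f \<and>
      (\<forall>t \<in> tables. f t = lewontin_D' t)"
    using continuous_on_lewontin_D' by blast
qed

end
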